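(* The stationary solutions of $$\tau_t = D_s\big(\tau^{-1/2}-\tau^{3/2}+D_s^2(\tau^{-1/2})\big)$$ are given by the following integral formula: $$\int\frac{du}{\sqrt{C+2Au-u^2-u^{-2}}}=s+k,$$ where $\tau(s)=u(s)^{-2}$ and where $A$, $k$ and $C$ are appropriate real constants. When $A=0$ we get an explicit formula for the solutions: $$\tau(s)=\frac{2}{C\pm\sqrt{-4+C^2}\cdot\sin(2(s+k))},$$ with $k$ and $C\geq 2$ real constants.
   Context: $D_s$ denotes the derivative with respect to $s$. The equation is the evolution equation of the torsion $\tau=\tau(s,t)>0$, as a function of arc-length $s$ and time $t$, for curves in $\mathbb{R}^3$ of constant curvature $1$ and strictly positive torsion moving by $X_t=\frac{1}{\sqrt{\tau}}\mathbf{B}$, where $\mathbf{B}$ is the unit binormal vector. A stationary solution is a solution $\tau$ that does not depend on $t$. *)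

theory Defs
  imports "HOL-Analysis.Analysis"
begin

definition torsion_flux :: "(real \<Rightarrow> real) \<Rightarrow> real \<Rightarrow> real" where
  "torsion_flux \<tau> s =
     \<tau> s powr (-1/2) - \<tau> s powr (3/2) + deriv (deriv (\<lambda>r. \<tau> r powr (-1/2))) s"

text \<open>Classical positive solutions for \<open>s\<close> in \<open>I\<close> (assumed open in all uses) and \<open>t\<close> in \<open>T\<close>.
  Three derivatives in \<open>s\<close> are what the right-hand side needs; demanding them explicitly
  keeps every occurrence of \<open>deriv\<close> meaningful.\<close>

definition torsion_evolution_solution ::
    "real set \<Rightarrow> real set \<Rightarrow> (real \<Rightarrow> real \<Rightarrow> real) \<Rightarrow> bool" where
  "torsion_evolution_solution I T \<tau> \<longleftrightarrow>
     (\<forall>s\<in>I. \<forall>t\<in>T.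
        0 < \<tau> s t \<and>
        (\<forall>n<3. (deriv ^^ n) (\<lambda>r. \<tau> r t) field_differentiable (at s)) \<and>
        ((\<lambda>t'. \<tau> s t') has_real_derivative deriv (torsion_flux (\<lambda>r. \<tau> r t)) s) (at t within T))"

definition stationary_solution :: "real set \<Rightarrow> (real \<Rightarrow> real) \<Rightarrow> bool" where
  "stationary_solution I \<tau> \<longleftrightarrow> torsion_evolution_solution I UNIV (\<lambda>s t. \<tau> s)"

definition radicand :: "real \<Rightarrow> real \<Rightarrow> real \<Rightarrow> real" where
  "radicand A C v = C + 2 * A * v - v\<^sup>2 - 1 / v\<^sup>2"

text \<open>The relation between \<open>u\<close> and \<open>s\<close> expressed by the indefinite integral of
  \<open>1 / sqrt (radicand A C v)\<close>: here \<open>F\<close> is an antiderivative on an interval \<open>V\<close> of positive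
  reals on which the integrand is defined.  The sign \<open>\<sigma>\<close> is the choice of the branch of the
  square root: \<open>\<sigma> = 1\<close> where \<open>u\<close> increases, \<open>\<sigma> = -1\<close> where it decreases.\<close>

definition integral_formula_on ::
    "real set \<Rightarrow> real \<Rightarrow> real \<Rightarrow> real \<Rightarrow> (real \<Rightarrow> real) \<Rightarrow> bool" where
  "integral_formula_on J A C k u \<longleftrightarrow>
     (\<exists>V F \<sigma>. open V \<and> is_interval V \<and> u ` J \<subseteq> V \<and>
        (\<forall>v\<in>V. 0 < v \<and> 0 < radicand A C v \<and>
               (F has_real_derivative 1 / sqrt (radicand A C v)) (at v)) \<and>
        \<sigma> \<in> {1, -1} \<and> (\<forall>s\<in>J. \<sigma> * F (u s) = s + k))"

text \<open>A solution may oscillate, so that \<open>radicand A C (u s)\<close> vanishes at turning points and the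
  integral formula can only hold between them, with \<open>k\<close> and the sign depending on the
  branch but \<open>A\<close> and \<open>C\<close> common to all branches.  The first clause is the formula in
  differential form; it also makes sense at turning points and for constant \<open>u\<close>, where the
  integrand is undefined.  The last clause says that for nonconstant \<open>u\<close> the points not
  covered by the integral formula are isolated.\<close>

definition given_by_integral_formula ::
    "real set \<Rightarrow> real \<Rightarrow> real \<Rightarrow> (real \<Rightarrow> real) \<Rightarrow> bool" where
  "given_by_integral_formula I A C u \<longleftrightarrow>
     (\<forall>s\<in>I. u field_differentiable (at s) \<and> (deriv u s)\<^sup>2 = radicand A C (u s)) \<and>
     (\<forall>J. open J \<and> is_interval J \<and> J \<subseteq> I \<and> (\<forall>s\<in>J. 0 < radicand A C (u s)) \<longrightarrow>
        (\<exists>k. integral_formula_on J A C k u)) \<and>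
     (\<not> u constant_on I \<longrightarrow> (\<forall>s\<in>I. \<not> s islimpt {r\<in>I. radicand A C (u r) = 0}))"

end

theory Submission
  imports Defs
begin

text \<open>With \<open>\<tau> = u\<^sup>-\<^sup>2\<close> the flux is \<open>u - u\<^sup>-\<^sup>3 + u''\<close>, so a stationary solution
  satisfies \<open>u'' = A - u + u\<^sup>-\<^sup>3\<close>, whose first integral is
  \<open>u'\<^sup>2 = C + 2 A u - u\<^sup>2 - u\<^sup>-\<^sup>2\<close>; separation of variables between zeros of \<open>u'\<close> gives the
  integral formula.  The right-hand side is strictly concave in \<open>u > 0\<close>: it is positive on an
  interval, and a double zero is a global maximum.  For \<open>A = 0\<close> the
  function \<open>y = u\<^sup>2 - C/2\<close> solves \<open>y'' = -4 y\<close> with \<open>y'\<^sup>2 + 4 y\<^sup>2 = C\<^sup>2 - 4\<close>.\<close>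

section \<open>The profile equation\<close>

text \<open>\<open>v\<close> stands for u', so the second-order equation becomes a first-order
  system stated without \<open>deriv\<close>, and its solutions carry their differentiability with
  them.\<close>

definition profile_ode :: "real set \<Rightarrow> real \<Rightarrow> (real \<Rightarrow> real) \<Rightarrow> (real \<Rightarrow> real) \<Rightarrow> bool" where
  "profile_ode I A u v \<longleftrightarrow>
     (\<forall>s\<in>I. 0 < u s \<and> (u has_real_derivative v s) (at s) \<and>
        (v has_real_derivative A - u s + 1 / u s ^ 3) (at s))"

lemma profile_odeD:
  assumes "profile_ode I A u v" and "s \<in> I"
  shows "0 < u s" and "(u has_real_derivative v s) (at s)"
    and "(v has_real_derivative A - u s + 1 / u s ^ 3) (at s)"
  using assms by (auto simp: profile_ode_def)

lemma profile_ode_subset: "profile_ode I A u v \<Longrightarrow> J \<subseteq> I \<Longrightarrow> profile_ode J A u v"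
  by (auto simp: profile_ode_def)

section \<open>Calculus on open sets and intervals\<close>

text \<open>On the open set \<open>S\<close> the function \<open>deriv f\<close> coincides with
  \<open>g\<close> and so inherits its derivative. Iterated \<open>deriv\<close> terms are computed
  this way below.\<close>

lemma DERIV_deriv_open:
  fixes f g :: "real \<Rightarrow> real"
  assumes "open S" and "s \<in> S"
    and f: "\<And>x. x \<in> S \<Longrightarrow> (f has_real_derivative g x) (at x)"
    and g: "(g has_real_derivative D) (at s)"
  shows "(deriv f has_real_derivative D) (at s)"
  using has_field_derivative_transform_within_open[OF g assms(1,2)] f
  by (metis DERIV_imp_deriv)

lemma zero_derivative_constant_on_interval:
  fixes f :: "real \<Rightarrow> real"
  assumes "open I" and "is_interval I"
    and "\<And>s. s \<in> I \<Longrightarrow> (f has_real_derivative 0) (at s)"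
  shows "\<exists>c. \<forall>s\<in>I. f s = c"
  using has_field_derivative_0_imp_constant_on[of I f] assms is_interval_connected[of I]
  by (simp add: constant_on_def)

text \<open>The interval may be unbounded, so it is rewritten as the set of reals between two
  extended real endpoints, where a continuous function has an antiderivative.\<close>

lemma open_interval_antiderivative:
  fixes f :: "real \<Rightarrow> real"
  assumes "open V" and V: "is_interval V" and cont: "\<And>x. x \<in> V \<Longrightarrow> isCont f x"
  shows "\<exists>F. \<forall>x\<in>V. (F has_real_derivative f x) (at x)"
proof (cases "V = {}")
  case False
  define a b where "a = (INF x\<in>V. ereal x)" and "b = (SUP x\<in>V. ereal x)"
  have mem: "a < ereal x \<and> ereal x < b \<longleftrightarrow> x \<in> V" for x
  proof
    assume "a < ereal x \<and> ereal x < b"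
    then obtain y z where "y \<in> V" "y < x" "z \<in> V" "x < z"
      unfolding a_def b_def INF_less_iff less_SUP_iff by auto
    then show "x \<in> V"
      using V unfolding is_interval_1 by (meson less_imp_le)
  next
    assume "x \<in> V"
    then obtain e where "0 < e" and e: "ball x e \<subseteq> V"
      using \<open>open V\<close> by (meson openE)
    then have "x - e / 2 \<in> V" "x + e / 2 \<in> V"
      by (auto simp: dist_real_def intro!: subsetD[OF e])
    then show "a < ereal x \<and> ereal x < b"
      using \<open>0 < e\<close> unfolding a_def b_def INF_less_iff less_SUP_iff
      by (force intro: bexI[of _ "x - e / 2"] bexI[of _ "x + e / 2"])
  qed
  have "a < b"
    using False mem by (metis all_not_in_conv less_trans)
  then obtain F where "\<forall>x. a < ereal x \<longrightarrow> ereal x < b \<longrightarrow> (F has_vector_derivative f x) (at x)"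
    using einterval_antiderivative[of a b f] cont mem by blast
  then show ?thesis
    using mem by (auto simp: has_real_derivative_iff_has_vector_derivative)
qed simp

section \<open>Concavity of the radicand\<close>

lemma radicand_has_derivative:
  assumes "v \<noteq> 0"
  shows "(radicand A C has_real_derivative 2 * (A - v + 1 / v ^ 3)) (at v)"
  unfolding radicand_def[abs_def] using assms
  by (auto intro!: derivative_eq_intros simp: field_simps power2_eq_square power3_eq_cube)

text \<open>The second derivative -2 - 6 / v^4 is at most -2, so the graph lies below a tangent
  parabola. The computation isolates the gap between 1 / w^2 and its tangent line at
  \<open>v\<close>, which has the factor (w - v)^2.\<close>

lemma radicand_le_tangent:
  assumes "0 < v" and "0 < w"
  shows "radicand A C w \<le> radicand A C v + 2 * (A - v + 1 / v ^ 3) * (w - v) - (w - v)\<^sup>2"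
proof -
  have "1 / w\<^sup>2 - 3 / v\<^sup>2 + 2 * w / v ^ 3 = (w - v)\<^sup>2 * (2 * w + v) / (w\<^sup>2 * v ^ 3)"
    using assms by (simp add: field_simps power2_eq_square power3_eq_cube)
  also have "\<dots> \<ge> 0"
    using assms by simp
  finally have "0 \<le> 1 / w\<^sup>2 - 3 / v\<^sup>2 + 2 * w / v ^ 3" .
  moreover have "radicand A C v + 2 * (A - v + 1 / v ^ 3) * (w - v) - (w - v)\<^sup>2 - radicand A C w
      = 1 / w\<^sup>2 - 3 / v\<^sup>2 + 2 * w / v ^ 3"
    using assms by (simp add: radicand_def field_simps power2_eq_square power3_eq_cube)
  ultimately show ?thesis by linarith
qed

text \<open>This set serves as the domain of the integrand. It is an interval because a concave
  function that is positive at two points is positive between them.\<close>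

lemma positive_radicand_interval:
  shows "open {v. 0 < v \<and> 0 < radicand A C v}" (is "open ?V")
    and "is_interval {v. 0 < v \<and> 0 < radicand A C v}"
proof -
  have "continuous_on {0<..} (radicand A C)"
    unfolding radicand_def[abs_def] by (intro continuous_intros) auto
  then have "open ({0<..} \<inter> radicand A C -` {0<..})"
    by (intro continuous_open_preimage) auto
  moreover have "{0<..} \<inter> radicand A C -` {0<..} = ?V" by auto
  ultimately show "open ?V" by simp
  have "0 < radicand A C v"
    if "0 < a" "0 < radicand A C a" "0 < radicand A C b" "a \<le> v" "v \<le> b" for a b v
  proof -
    let ?m = "2 * (A - v + 1 / v ^ 3)"
    have "radicand A C a \<le> radicand A C v + ?m * (a - v)"
         "radicand A C b \<le> radicand A C v + ?m * (b - v)"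
      using radicand_le_tangent[of v a A C] radicand_le_tangent[of v b A C] that
      by (smt (verit) zero_le_power2)+
    \<comment> \<open>Whatever the sign of the slope at \<open>v\<close>, the tangent line does not
      rise towards one of the two endpoints, and the value at that endpoint bounds the value at
      \<open>v\<close> from below.\<close>
    moreover have "?m * (a - v) \<le> 0 \<or> ?m * (b - v) \<le> 0"
      using that by (smt (verit) mult_nonneg_nonpos mult_nonpos_nonneg)
    ultimately show ?thesis using that by linarith
  qed
  then show "is_interval ?V"
    unfolding is_interval_1 by (auto intro: less_le_trans)
qed

section \<open>First integral and separation of variables\<close>

text \<open>Multiplying u'' = A - u + u^-3 by 2 u' makes both sides exact derivatives;
  \<open>C\<close> is the constant of integration.\<close>

lemma profile_ode_first_integral:
  assumes ode: "profile_ode I A u v" and "open I" and "is_interval I"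
  shows "\<exists>C. \<forall>s\<in>I. (v s)\<^sup>2 = radicand A C (u s)"
proof -
  \<comment> \<open>\<open>radicand A 0\<close> leaves out the constant, so the conserved difference
    is \<open>C\<close> itself.\<close>
  have "((\<lambda>s. (v s)\<^sup>2 - radicand A 0 (u s)) has_real_derivative 0) (at s)" if "s \<in> I" for s
    using profile_odeD[OF ode that] radicand_has_derivative[of "u s" A 0]
    by (auto intro!: derivative_eq_intros DERIV_chain2[where f = "radicand A 0"])
  then have "\<exists>C. \<forall>s\<in>I. (v s)\<^sup>2 - radicand A 0 (u s) = C"
    by (rule zero_derivative_constant_on_interval[OF assms(2,3)])
  then show ?thesis
    by (simp add: radicand_def algebra_simps)
qed

text \<open>The intermediate value theorem excludes a change of sign. The sign found here selects
  the branch of the square root.\<close>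

lemma constant_sign_on_interval:
  fixes v :: "real \<Rightarrow> real"
  assumes "is_interval J" and "continuous_on J v" and "\<And>s. s \<in> J \<Longrightarrow> v s \<noteq> 0"
  obtains \<sigma> :: real where "\<sigma> \<in> {1, -1}" and "\<And>s. s \<in> J \<Longrightarrow> v s = \<sigma> * \<bar>v s\<bar>"
proof -
  have "is_interval (v ` J)"
    using assms(1,2) by (simp add: connected_continuous_image is_interval_connected_1)
  then have "(\<forall>s\<in>J. 0 < v s) \<or> (\<forall>s\<in>J. v s < 0)"
    using assms(3) unfolding is_interval_1
    by (smt (verit) imageE imageI)
  then show thesis
  proof
    assume "\<forall>s\<in>J. 0 < v s"
    then show thesis by (intro that[of 1]) auto
  next
    assume "\<forall>s\<in>J. v s < 0"
    then show thesis by (intro that[of "-1"]) auto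
  qed
qed

text \<open>Between turning points u' = \<sigma> sqrt (radicand), so \<sigma> F(u(s)) has derivative
  1 and differs from s by a constant \<open>k\<close>.\<close>

lemma profile_ode_imp_integral_formula_on:
  assumes ode: "profile_ode J A u v" and "open J" and J: "is_interval J"
    and first: "\<And>s. s \<in> J \<Longrightarrow> (v s)\<^sup>2 = radicand A C (u s)"
    and pos: "\<And>s. s \<in> J \<Longrightarrow> 0 < radicand A C (u s)"
  shows "\<exists>k. integral_formula_on J A C k u"
proof -
  define V where "V = {v. 0 < v \<and> 0 < radicand A C v}"
  have "isCont (\<lambda>v. 1 / sqrt (radicand A C v)) x" if "x \<in> V" for x
    using that DERIV_isCont[OF radicand_has_derivative[of x A C]]
    by (auto simp: V_def intro!: continuous_intros)
  then obtain F where F: "\<And>x. x \<in> V \<Longrightarrow> (F has_real_derivative 1 / sqrt (radicand A C x)) (at x)"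
    using open_interval_antiderivative[of V] positive_radicand_interval[of A C]
    unfolding V_def by blast
  have uV: "u s \<in> V" if "s \<in> J" for s
    using pos[OF that] profile_odeD(1)[OF ode that] by (simp add: V_def)
  have "continuous_on J v"
    using profile_odeD(3)[OF ode] by (meson DERIV_isCont continuous_at_imp_continuous_on)
  moreover have "v s \<noteq> 0" if "s \<in> J" for s
    using first[OF that] pos[OF that] by auto
  ultimately obtain \<sigma> :: real where \<sigma>: "\<sigma> \<in> {1, -1}" "\<And>s. s \<in> J \<Longrightarrow> v s = \<sigma> * \<bar>v s\<bar>"
    using constant_sign_on_interval[OF J] by blast
  have "((\<lambda>s. \<sigma> * F (u s) - s) has_real_derivative 0) (at s)" if "s \<in> J" for s
  proof -
    have "\<sigma> * (1 / sqrt (radicand A C (u s)) * v s) = 1"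
      using first[OF that, symmetric] pos[OF that] \<sigma>(1) \<sigma>(2)[OF that]
      by (auto simp: field_simps)
    moreover have "((\<lambda>s. F (u s)) has_real_derivative 1 / sqrt (radicand A C (u s)) * v s) (at s)"
      by (rule DERIV_chain2) (use F[OF uV] profile_odeD(2)[OF ode] that in auto)
    ultimately show ?thesis
      by (auto intro!: derivative_eq_intros)
  qed
  then have "\<exists>k. \<forall>s\<in>J. \<sigma> * F (u s) - s = k"
    by (rule zero_derivative_constant_on_interval[OF \<open>open J\<close> J])
  then obtain k where k: "\<And>s. s \<in> J \<Longrightarrow> \<sigma> * F (u s) - s = k" by blast
  have "integral_formula_on J A C k u"
    unfolding integral_formula_on_def
  proof (intro exI[of _ V] exI[of _ F] exI[of _ \<sigma>] conjI ballI)
    show "open V" "is_interval V"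
      unfolding V_def by (rule positive_radicand_interval)+
    show "u ` J \<subseteq> V" using uV by blast
    show "\<sigma> * F (u s) = s + k" if "s \<in> J" for s
      using k[OF that] by simp
  qed (use F \<sigma>(1) in \<open>auto simp: V_def\<close>)
  then show ?thesis ..
qed

text \<open>At a double zero of the radicand along a solution, strict concavity makes the radicand
  negative at all other positive values, so the solution stays there.\<close>

lemma profile_ode_zeros_isolated:
  assumes ode: "profile_ode I A u v" and "s \<in> I"
    and first: "\<And>r. r \<in> I \<Longrightarrow> (v r)\<^sup>2 = radicand A C (u r)"
    and lim: "s islimpt {r\<in>I. radicand A C (u r) = 0}"
  shows "u constant_on I"
proof -
  note at_s = profile_odeD[OF ode \<open>s \<in> I\<close>]
  \<comment> \<open>The accumulating zeros of the radicand are zeros of \<open>v\<close>. Continuity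
    then forces v(s) = 0, and difference quotients vanishing arbitrarily close to \<open>s\<close>
    force v'(s) = 0, so u(s) is a double zero.\<close>
  have freq: "\<exists>\<^sub>F r in at s. v r = 0"
    using lim unfolding islimpt_iff_eventually frequently_def
    by (rule contrapos_nn) (auto elim!: eventually_mono simp flip: first)
  have tends: "(v \<longlongrightarrow> v s) (at s)"
    using DERIV_isCont[OF at_s(3)] by (simp add: isCont_def)
  have "v s = 0"
  proof (rule ccontr)
    assume "v s \<noteq> 0"
    then have "\<forall>\<^sub>F r in at s. v r \<noteq> 0"
      by (rule tendsto_imp_eventually_ne[OF tends])
    with freq show False by (simp add: frequently_def)
  qed
  have "A - u s + 1 / u s ^ 3 = 0"
  proof (rule ccontr)
    assume "A - u s + 1 / u s ^ 3 \<noteq> 0"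
    then have "\<forall>\<^sub>F r in at s. (v r - v s) / (r - s) \<noteq> 0"
      using at_s(3) tendsto_imp_eventually_ne unfolding has_field_derivative_iff by blast
    then have "\<forall>\<^sub>F r in at s. v r \<noteq> 0"
      by eventually_elim (simp add: \<open>v s = 0\<close>)
    with freq show False by (simp add: frequently_def)
  qed
  \<comment> \<open>The tangent bound at u(s) reduces to 0 \<le> v(r)^2 \<le> -(u(r) -
    u(s))^2.\<close>
  then have "u r = u s" if "r \<in> I" for r
    using radicand_le_tangent[of "u s" "u r" A C] first[OF that] first[OF \<open>s \<in> I\<close>] \<open>v s = 0\<close>
      profile_odeD(1)[OF ode that] at_s(1)
    by (smt (verit) mult_eq_0_iff zero_le_power2 zero_eq_power2)
  then show ?thesis
    by (auto simp: constant_on_def)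
qed

lemma profile_ode_imp_given_by_integral_formula:
  assumes ode: "profile_ode I A u v"
    and first: "\<And>s. s \<in> I \<Longrightarrow> (v s)\<^sup>2 = radicand A C (u s)"
  shows "given_by_integral_formula I A C u"
  unfolding given_by_integral_formula_def
proof (intro conjI ballI allI impI)
  fix s assume "s \<in> I"
  then show "u field_differentiable at s" "(deriv u s)\<^sup>2 = radicand A C (u s)"
    using profile_odeD(2)[OF ode \<open>s \<in> I\<close>] DERIV_imp_deriv first
    by (force simp: field_differentiable_def)+
next
  fix J assume "open J \<and> is_interval J \<and> J \<subseteq> I \<and> (\<forall>s\<in>J. 0 < radicand A C (u s))"
  then show "\<exists>k. integral_formula_on J A C k u"
    using profile_ode_imp_integral_formula_on profile_ode_subset[OF ode] first by blast
next
  fix s assume "\<not> u constant_on I" "s \<in> I"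
  then show "\<not> s islimpt {r \<in> I. radicand A C (u r) = 0}"
    using profile_ode_zeros_isolated[OF ode _ first] by blast
qed

section \<open>Passing between the torsion and its profile\<close>

lemma inverse_square_powr:
  fixes x :: real
  assumes "0 < x"
  shows "(1 / x\<^sup>2) powr (-1/2) = x" and "(1 / x\<^sup>2) powr (3/2) = 1 / x ^ 3"
proof -
  have *: "1 / x\<^sup>2 = x powr (-2)"
    using assms by (simp add: powr_minus powr_numeral field_simps)
  show "(1 / x\<^sup>2) powr (-1/2) = x" "(1 / x\<^sup>2) powr (3/2) = 1 / x ^ 3"
    unfolding * powr_powr using assms by (simp_all add: powr_minus powr_numeral field_simps)
qed

text \<open>The profile equation says that the flux u - u^-3 + u'' equals \<open>A\<close>, and a
  constant flux has derivative zero. The rest of the proof supplies the three orders of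
  differentiability demanded of a solution.\<close>

lemma profile_ode_imp_stationary:
  assumes ode: "profile_ode I A u v" and "open I" and \<tau>: "\<And>s. s \<in> I \<Longrightarrow> \<tau> s = 1 / (u s)\<^sup>2"
  shows "stationary_solution I \<tau>" and "\<And>s. s \<in> I \<Longrightarrow> torsion_flux \<tau> s = A"
proof -
  define a where "a s = A - u s + 1 / u s ^ 3" for s
  have pos: "0 < u s" and u: "(u has_real_derivative v s) (at s)"
    and v: "(v has_real_derivative a s) (at s)" if "s \<in> I" for s
    using profile_odeD[OF ode that] by (auto simp: a_def)
  have u_eq: "u s = \<tau> s powr (-1/2)" if "s \<in> I" for s
    using \<tau>[OF that] inverse_square_powr(1)[OF pos[OF that]] by simp
  have d1: "(deriv (\<lambda>r. \<tau> r powr (-1/2)) has_real_derivative a s) (at s)" if "s \<in> I" for s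
    using DERIV_deriv_open[OF \<open>open I\<close> that _ v[OF that], of "\<lambda>r. \<tau> r powr (-1/2)"]
      has_field_derivative_transform_within_open[OF u \<open>open I\<close> _ u_eq] by blast
  show flux: "torsion_flux \<tau> s = A" if "s \<in> I" for s
    using DERIV_imp_deriv[OF d1[OF that]] inverse_square_powr[OF pos[OF that]] \<tau>[OF that]
    by (simp add: torsion_flux_def a_def)
  have flux0: "(torsion_flux \<tau> has_real_derivative 0) (at s)" if "s \<in> I" for s
    using has_field_derivative_transform_within_open[OF DERIV_const[of A] \<open>open I\<close> that]
      flux by simp
  \<comment> \<open>\<open>t1\<close> and \<open>t2\<close> are the first two derivatives of u^-2,
    with u' = v and u'' = a inserted. As \<open>a\<close> is rational in \<open>u\<close>,
    \<open>t2\<close> is differentiable again, which gives the third derivative.\<close>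
  define t1 where "t1 s = - 2 * v s / u s ^ 3" for s
  define t2 where "t2 s = 6 * (v s)\<^sup>2 / u s ^ 4 - 2 * a s / u s ^ 3" for s
  have "((\<lambda>s. 1 / (u s)\<^sup>2) has_real_derivative t1 s) (at s)" if "s \<in> I" for s
    using pos[OF that] u[OF that] unfolding t1_def
    by (auto intro!: derivative_eq_intros simp: field_simps power2_eq_square power3_eq_cube)
  then have \<tau>1: "(\<tau> has_real_derivative t1 s) (at s)" if "s \<in> I" for s
    using has_field_derivative_transform_within_open[OF _ \<open>open I\<close> that, of "\<lambda>s. 1 / (u s)\<^sup>2"] that \<tau>
    by simp
  have "(t1 has_real_derivative t2 s) (at s)" if "s \<in> I" for s
    using pos[OF that] u[OF that] v[OF that] unfolding t1_def[abs_def] t2_def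
    by (auto intro!: derivative_eq_intros
        simp: field_simps power2_eq_square power3_eq_cube power4_eq_xxxx)
  then have \<tau>2: "(deriv \<tau> has_real_derivative t2 s) (at s)" if "s \<in> I" for s
    using DERIV_deriv_open[OF \<open>open I\<close> that \<tau>1] that by blast
  have "\<exists>D. (t2 has_real_derivative D) (at s)" if "s \<in> I" for s
    using pos[OF that] u[OF that] v[OF that] unfolding t2_def[abs_def] a_def[abs_def]
    by (intro exI) (auto intro!: derivative_eq_intros)
  then have \<tau>3: "deriv (deriv \<tau>) field_differentiable at s" if "s \<in> I" for s
    using DERIV_deriv_open[OF \<open>open I\<close> that \<tau>2] that
    unfolding field_differentiable_def by blast
  have "(deriv ^^ n) \<tau> field_differentiable at s" if "s \<in> I" "n < 3" for s n
  proof -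
    consider "n = 0" | "n = 1" | "n = 2" using \<open>n < 3\<close> by linarith
    then show ?thesis
      using \<tau>1[OF \<open>s \<in> I\<close>] \<tau>2[OF \<open>s \<in> I\<close>] \<tau>3[OF \<open>s \<in> I\<close>]
      by cases (auto simp: field_differentiable_def numeral_2_eq_2)
  qed
  then show "stationary_solution I \<tau>"
    using \<tau> pos DERIV_imp_deriv[OF flux0]
    by (simp add: less_imp_neq[OF pos, symmetric] stationary_solution_def torsion_evolution_solution_def)
qed

text \<open>Independence of time makes the derivative of the flux vanish, and the definition of the
  flux, solved for u'', is the equation for \<open>u\<close>. The flux is not yet replaced by a
  number: it becomes one only after integration over an interval.\<close>

lemma stationary_solution_flux_and_ode:
  fixes \<tau> u :: "real \<Rightarrow> real"
  assumes st: "stationary_solution I \<tau>" and "open I"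
    and u: "\<And>s. s \<in> I \<Longrightarrow> 0 < u s \<and> \<tau> s = 1 / (u s)\<^sup>2"
  shows "\<And>s. s \<in> I \<Longrightarrow> (torsion_flux \<tau> has_real_derivative 0) (at s)"
    and "\<exists>v. \<forall>s\<in>I. (u has_real_derivative v s) (at s) \<and>
           (v has_real_derivative torsion_flux \<tau> s - u s + 1 / u s ^ 3) (at s)"
proof -
  let ?w = "\<lambda>r. \<tau> r powr (-1/2)"
  define t1 t2 t3 where "t1 = deriv \<tau>" and "t2 = deriv t1" and "t3 = deriv t2"
  have st': "0 < \<tau> s" "\<And>n. n < 3 \<Longrightarrow> (deriv ^^ n) \<tau> field_differentiable at s"
    "((\<lambda>t. \<tau> s) has_real_derivative deriv (torsion_flux \<tau>) s) (at 0)" if "s \<in> I" for s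
    using st that by (auto simp: stationary_solution_def torsion_evolution_solution_def)
  have \<tau>0: "(\<tau> has_real_derivative t1 s) (at s)" and \<tau>1: "(t1 has_real_derivative t2 s) (at s)"
    and \<tau>2: "(t2 has_real_derivative t3 s) (at s)" if "s \<in> I" for s
    using st'(2)[OF that, of 0] st'(2)[OF that, of 1] st'(2)[OF that, of 2]
    by (auto simp: t1_def t2_def t3_def numeral_2_eq_2 field_differentiable_derivI)
  \<comment> \<open>\<open>w1\<close> and \<open>w2\<close> are the first two derivatives of
    \<open>?w\<close>, which agrees with \<open>u\<close> on \<open>I\<close>.\<close>
  define w1 where "w1 s = -1/2 * \<tau> s powr (-3/2) * t1 s" for s
  define w2 where "w2 s = 3/4 * \<tau> s powr (-5/2) * (t1 s)\<^sup>2 - 1/2 * \<tau> s powr (-3/2) * t2 s" for s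
  have w1: "(?w has_real_derivative w1 s) (at s)" if "s \<in> I" for s
    using \<tau>0[OF that] st'(1)[OF that] unfolding w1_def
    by (auto intro!: derivative_eq_intros)
  have w2: "(w1 has_real_derivative w2 s) (at s)" if "s \<in> I" for s
    using \<tau>0[OF that] \<tau>1[OF that] st'(1)[OF that] unfolding w1_def[abs_def] w2_def
    by (auto intro!: derivative_eq_intros simp: power2_eq_square field_simps)
  have dd: "deriv (deriv ?w) s = w2 s" if "s \<in> I" for s
    using DERIV_deriv_open[OF \<open>open I\<close> that w1 w2[OF that]] by (rule DERIV_imp_deriv)
  have u_eq: "?w s = u s" if "s \<in> I" for s
    using u[OF that] inverse_square_powr(1)[of "u s"] by simp
  have u1: "(u has_real_derivative w1 s) (at s)" if "s \<in> I" for s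
    using has_field_derivative_transform_within_open[OF w1[OF that] \<open>open I\<close> that u_eq] .
  have flux: "torsion_flux \<tau> s = u s - 1 / u s ^ 3 + w2 s" if "s \<in> I" for s
    using u[OF that] inverse_square_powr[of "u s"] dd[OF that] by (simp add: torsion_flux_def)
  show "(torsion_flux \<tau> has_real_derivative 0) (at s)" if "s \<in> I" for s
  proof -
    \<comment> \<open>\<open>w2\<close> contains \<open>t2\<close>, so the third derivative of
      \<tau> enters here; it makes the \<open>deriv\<close> of the flux a genuine
      derivative.\<close>
    have "\<exists>D. ((\<lambda>s. ?w s - \<tau> s powr (3/2) + w2 s) has_real_derivative D) (at s)"
      using \<tau>0[OF that] \<tau>1[OF that] \<tau>2[OF that] st'(1)[OF that] unfolding w2_def[abs_def]
      by (intro exI) (auto intro!: derivative_eq_intros)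
    then obtain D where "((\<lambda>s. ?w s - \<tau> s powr (3/2) + w2 s) has_real_derivative D) (at s)" ..
    then have D: "(torsion_flux \<tau> has_real_derivative D) (at s)"
      by (rule has_field_derivative_transform_within_open[OF _ \<open>open I\<close> that])
        (simp only: torsion_flux_def dd)
    \<comment> \<open>By the evolution equation \<open>D\<close> is the time derivative of a
      function that is constant in time.\<close>
    then have "D = 0"
      using DERIV_imp_deriv[OF D] DERIV_unique[OF st'(3)[OF that] DERIV_const] by simp
    with D show ?thesis by simp
  qed
  show "\<exists>v. \<forall>s\<in>I. (u has_real_derivative v s) (at s) \<and>
           (v has_real_derivative torsion_flux \<tau> s - u s + 1 / u s ^ 3) (at s)"
    using u1 w2 flux by (intro exI[of _ w1]) auto
qed

section \<open>Inverting the integral formula\<close>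

text \<open>The regularity of \<open>u\<close> is recovered by inverting \<open>F\<close>, which is
  strictly increasing on \<open>V\<close>: u(s) = G(\<sigma> (s + k)) has derivative \<sigma> sqrt
  (radicand), and differentiating once more gives the equation for u''.\<close>

lemma integral_formula_on_imp_profile_ode:
  assumes "integral_formula_on I A C k u" and "open I"
  shows "\<exists>v. profile_ode I A u v"
proof -
  obtain V F and \<sigma> :: real where "open V" and V: "is_interval V" and uV: "u ` I \<subseteq> V"
    and pos: "\<And>x. x \<in> V \<Longrightarrow> 0 < x \<and> 0 < radicand A C x"
    and F: "\<And>x. x \<in> V \<Longrightarrow> (F has_real_derivative 1 / sqrt (radicand A C x)) (at x)"
    and \<sigma>: "\<sigma> \<in> {1, -1}" and Fu: "\<And>s. s \<in> I \<Longrightarrow> \<sigma> * F (u s) = s + k"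
    using assms(1) unfolding integral_formula_on_def by blast
  have less: "F x < F y" if "x \<in> V" "y \<in> V" "x < y" for x y
  proof (rule DERIV_pos_imp_increasing[OF \<open>x < y\<close>])
    fix z assume "x \<le> z" "z \<le> y"
    then have "z \<in> V" using V that unfolding is_interval_1 by blast
    then show "\<exists>D. DERIV F z :> D \<and> 0 < D" using F pos by fastforce
  qed
  define G where "G = inv_into V F"
  have "inj_on F V"
    by (rule linorder_inj_onI') (use less in force)
  then have GF: "G (F x) = x" if "x \<in> V" for x
    using that by (simp add: G_def)
  have contF: "continuous_on V F"
    using F by (meson DERIV_isCont continuous_at_imp_continuous_on)
  have dG: "(G has_real_derivative sqrt (radicand A C x)) (at (F x))" if "x \<in> V" for x
    unfolding has_field_derivative_def
  proof (rule has_derivative_inverse_strong[OF \<open>open V\<close> that contF GF])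
    show "(F has_derivative (*) (1 / sqrt (radicand A C x))) (at x)"
      using F[OF that] by (simp add: has_field_derivative_def)
    show "(*) (1 / sqrt (radicand A C x)) \<circ> (*) (sqrt (radicand A C x)) = id"
      using pos[OF that] by (auto simp: fun_eq_iff)
  qed
  \<comment> \<open>The sign changes sides because \<sigma>^2 = 1.\<close>
  have Fu': "F (u s) = \<sigma> * (s + k)" if "s \<in> I" for s
    using Fu[OF that] \<sigma> by auto
  have u_eq: "G (\<sigma> * (s + k)) = u s" if "s \<in> I" for s
    using GF[of "u s"] Fu'[OF that] uV that by auto
  define v where "v s = \<sigma> * sqrt (radicand A C (u s))" for s
  have du: "(u has_real_derivative v s) (at s)" if "s \<in> I" for s
  proof (rule has_field_derivative_transform_within_open[OF _ \<open>open I\<close> that u_eq])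
    have "(G has_real_derivative sqrt (radicand A C (u s))) (at (\<sigma> * (s + k)))"
      using dG[of "u s"] Fu'[OF that] uV that by auto
    then show "((\<lambda>s. G (\<sigma> * (s + k))) has_real_derivative v s) (at s)"
      unfolding v_def by (rule DERIV_chain2[THEN DERIV_cong]) (auto intro!: derivative_eq_intros)
  qed
  have "(v has_real_derivative A - u s + 1 / u s ^ 3) (at s)" if "s \<in> I" for s
  proof -
    have P: "0 < u s" "0 < radicand A C (u s)"
      using pos uV that by auto
    have "((\<lambda>s. radicand A C (u s)) has_real_derivative 2 * (A - u s + 1 / u s ^ 3) * v s) (at s)"
      using P radicand_has_derivative[of "u s" A C] du[OF that] by (auto intro: DERIV_chain2)
    then have "((\<lambda>s. \<sigma> * sqrt (radicand A C (u s))) has_real_derivative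
        \<sigma> * (2 * (A - u s + 1 / u s ^ 3) * v s / (2 * sqrt (radicand A C (u s))))) (at s)"
      using P by (auto intro!: derivative_eq_intros simp: field_simps)
    \<comment> \<open>The factor \<open>v\<close> from the chain rule cancels the square root up to
      \<sigma>, and \<sigma>^2 = 1.\<close>
    moreover have "\<sigma> * (2 * (A - u s + 1 / u s ^ 3) * v s / (2 * sqrt (radicand A C (u s))))
        = A - u s + 1 / u s ^ 3"
      using P \<sigma> by (auto simp: v_def)
    ultimately show ?thesis by (simp add: v_def[abs_def])
  qed
  then show ?thesis
    using du pos uV unfolding profile_ode_def by blast
qed

section \<open>Zero flux and the harmonic oscillator\<close>

text \<open>In complex form (z + i y) exp (-2 i s) is a constant p + i q. The energy puts it on the
  circle of radius |R| about 0, and for nonzero \<open>R\<close> half the argument of (p + i q) / R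
  is the phase \<open>k\<close>.\<close>

lemma harmonic_oscillator:
  fixes y z :: "real \<Rightarrow> real"
  assumes I: "open I" "is_interval I" "I \<noteq> {}"
    and y: "\<And>s. s \<in> I \<Longrightarrow> (y has_real_derivative 2 * z s) (at s)"
    and z: "\<And>s. s \<in> I \<Longrightarrow> (z has_real_derivative - 2 * y s) (at s)"
    and energy: "\<And>s. s \<in> I \<Longrightarrow> (y s)\<^sup>2 + (z s)\<^sup>2 = R\<^sup>2"
  shows "\<exists>k. \<forall>s\<in>I. y s = R * sin (2 * (s + k))"
proof -
  have "((\<lambda>s. y s * sin (2 * s) + z s * cos (2 * s)) has_real_derivative 0) (at s)"
    if "s \<in> I" for s
    using y[OF that] z[OF that] by (auto intro!: derivative_eq_intros simp: algebra_simps)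
  then have "\<exists>p. \<forall>s\<in>I. y s * sin (2 * s) + z s * cos (2 * s) = p"
    by (rule zero_derivative_constant_on_interval[OF I(1,2)])
  then obtain p where p: "\<And>s. s \<in> I \<Longrightarrow> y s * sin (2 * s) + z s * cos (2 * s) = p" by blast
  have "((\<lambda>s. y s * cos (2 * s) - z s * sin (2 * s)) has_real_derivative 0) (at s)"
    if "s \<in> I" for s
    using y[OF that] z[OF that] by (auto intro!: derivative_eq_intros simp: algebra_simps)
  then have "\<exists>q. \<forall>s\<in>I. y s * cos (2 * s) - z s * sin (2 * s) = q"
    by (rule zero_derivative_constant_on_interval[OF I(1,2)])
  then obtain q where q: "\<And>s. s \<in> I \<Longrightarrow> y s * cos (2 * s) - z s * sin (2 * s) = q" by blast
  have rot: "p\<^sup>2 + q\<^sup>2 = R\<^sup>2" "y s = p * sin (2 * s) + q * cos (2 * s)" if "s \<in> I" for s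
  proof -
    note pq = p[OF that, symmetric] q[OF that, symmetric]
    have sc: "(sin (2 * s))\<^sup>2 + (cos (2 * s))\<^sup>2 = 1" by simp
    have "p\<^sup>2 + q\<^sup>2 = ((y s)\<^sup>2 + (z s)\<^sup>2) * ((sin (2 * s))\<^sup>2 + (cos (2 * s))\<^sup>2)"
      unfolding pq by algebra
    then show "p\<^sup>2 + q\<^sup>2 = R\<^sup>2" using energy[OF that] sc by simp
    have "p * sin (2 * s) + q * cos (2 * s) = y s * ((sin (2 * s))\<^sup>2 + (cos (2 * s))\<^sup>2)"
      unfolding pq by algebra
    then show "y s = p * sin (2 * s) + q * cos (2 * s)" using sc by simp
  qed
  \<comment> \<open>The identity p^2 + q^2 = R^2 was obtained at points of \<open>I\<close>, so one
    such point is needed. If R = 0, then p = q = 0 and the angle 0 is taken.\<close>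
  obtain \<phi> where \<phi>: "p = R * cos \<phi>" "q = R * sin \<phi>"
  proof (cases "R = 0")
    case True
    then show thesis using that[of 0] rot(1) I(3) by auto
  next
    case False
    then have "(p / R)\<^sup>2 + (q / R)\<^sup>2 = 1"
      using rot(1) I(3) by (auto simp: power_divide add_divide_distrib[symmetric])
    then obtain t where "p / R = cos t" "q / R = sin t"
      using sincos_total_2pi by blast
    then show thesis using that[of t] False by (auto simp: field_simps)
  qed
  have "y s = R * sin (2 * (s + \<phi> / 2))" if "s \<in> I" for s
    using rot(2)[OF that] by (simp add: \<phi> sin_add algebra_simps)
  then show ?thesis by blast
qed

text \<open>For A = 0 the square of \<open>u\<close>, shifted by C / 2, oscillates with angular
  frequency 2, and the first integral gives the amplitude sqrt (C^2 - 4) / 2.\<close>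

lemma zero_flux_explicit:
  assumes ode: "profile_ode I 0 u v" and I: "open I" "is_interval I" "I \<noteq> {}"
    and first: "\<And>s. s \<in> I \<Longrightarrow> (v s)\<^sup>2 = radicand 0 C (u s)"
  shows "2 \<le> C" and "\<exists>k. \<forall>s\<in>I. (u s)\<^sup>2 = (C + sqrt (-4 + C\<^sup>2) * sin (2 * (s + k))) / 2"
proof -
  obtain s0 where "s0 \<in> I" using I(3) by blast
  then have "0 < u s0" "0 \<le> radicand 0 C (u s0)"
    using profile_odeD(1)[OF ode] first by (metis zero_le_power2)+
  \<comment> \<open>Completing the square writes C - 2 as a sum of two nonnegative terms.\<close>
  moreover have "C - 2 - radicand 0 C (u s0) = (u s0 - 1 / u s0)\<^sup>2"
    using \<open>0 < u s0\<close> by (simp add: radicand_def field_simps power2_eq_square)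
  ultimately show "2 \<le> C"
    by (smt (verit) zero_le_power2)
  then have "2\<^sup>2 \<le> C\<^sup>2"
    by (intro power_mono) auto
  define y where "y s = (u s)\<^sup>2 - C / 2" for s
  \<comment> \<open>\<open>z\<close> is half the derivative of \<open>y\<close>, and z' = v^2 + u
    u'' = C - 2 u^2 = -2 y.\<close>
  define z where "z s = u s * v s" for s
  have "\<exists>k. \<forall>s\<in>I. y s = (sqrt (-4 + C\<^sup>2) / 2) * sin (2 * (s + k))"
  proof (rule harmonic_oscillator[OF I])
    fix s assume "s \<in> I"
    note d = profile_odeD[OF ode \<open>s \<in> I\<close>]
    have v2: "(v s)\<^sup>2 = C - (u s)\<^sup>2 - 1 / (u s)\<^sup>2"
      using first[OF \<open>s \<in> I\<close>] by (simp add: radicand_def)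
    show "(y has_real_derivative 2 * z s) (at s)"
      unfolding y_def[abs_def] z_def using d by (auto intro!: derivative_eq_intros)
    have "u s * (0 - u s + 1 / u s ^ 3) = 1 / (u s)\<^sup>2 - (u s)\<^sup>2"
      using d(1) by (simp add: field_simps power2_eq_square power3_eq_cube)
    then have "v s * v s + u s * (0 - u s + 1 / u s ^ 3) = - 2 * y s"
      using v2 by (simp only: y_def power2_eq_square[of "v s"]) simp
    then show "(z has_real_derivative - 2 * y s) (at s)"
      unfolding z_def[abs_def] using d by (auto intro!: derivative_eq_intros simp: mult.commute)
    have "(z s)\<^sup>2 = C * (u s)\<^sup>2 - (u s)\<^sup>2 * (u s)\<^sup>2 - 1"
      using d(1) by (simp add: z_def power_mult_distrib v2 field_simps)
    then show "(y s)\<^sup>2 + (z s)\<^sup>2 = (sqrt (-4 + C\<^sup>2) / 2)\<^sup>2"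
      using \<open>2\<^sup>2 \<le> C\<^sup>2\<close> by (simp add: y_def power_divide power2_diff field_simps)
  qed
  then obtain k where k: "\<And>s. s \<in> I \<Longrightarrow> y s = (sqrt (-4 + C\<^sup>2) / 2) * sin (2 * (s + k))"
    by blast
  have "(u s)\<^sup>2 = (C + sqrt (-4 + C\<^sup>2) * sin (2 * (s + k))) / 2" if "s \<in> I" for s
    using k[OF that] by (simp add: y_def field_simps)
  then show "\<exists>k. \<forall>s\<in>I. (u s)\<^sup>2 = (C + sqrt (-4 + C\<^sup>2) * sin (2 * (s + k))) / 2"
    by blast
qed

text \<open>The function w = u^2 oscillates about C / 2 with amplitude |R| / 2 < C / 2, hence stays
  positive on the whole line, and sin^2 + cos^2 = 1 turns into the first integral.\<close>

lemma explicit_profile_ode: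
  fixes C k \<sigma> :: real
  assumes "2 \<le> C" and \<sigma>: "\<sigma> \<in> {1, -1}"
  defines "w \<equiv> \<lambda>s. (C + \<sigma> * sqrt (-4 + C\<^sup>2) * sin (2 * (s + k))) / 2"
  defines "u \<equiv> \<lambda>s. sqrt (w s)"
  shows "0 < w s"
    and "\<exists>v. profile_ode UNIV 0 u v \<and> (\<forall>s. (v s)\<^sup>2 = radicand 0 C (u s))"
proof -
  \<comment> \<open>The sign is absorbed into \<open>R\<close>; R^2 = C^2 - 4 holds for both
    choices.\<close>
  define R where "R = \<sigma> * sqrt (-4 + C\<^sup>2)"
  have "2\<^sup>2 \<le> C\<^sup>2"
    using \<open>2 \<le> C\<close> by (intro power_mono) auto
  then have R2: "R\<^sup>2 = -4 + C\<^sup>2"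
    using \<sigma> by (auto simp: R_def)
  then have "\<bar>R\<bar> < \<bar>C\<bar>"
    using abs_le_square_iff[of C R] by linarith
  have w_def': "w s = (C + R * sin (2 * (s + k))) / 2" for s
    by (simp add: w_def R_def)
  have w_pos: "0 < w s" for s
  proof -
    have "\<bar>R * sin (2 * (s + k))\<bar> \<le> \<bar>R\<bar>"
      by (simp add: abs_mult mult_left_le)
    moreover have "0 < C + x" if "\<bar>x\<bar> \<le> \<bar>R\<bar>" for x
      using \<open>\<bar>R\<bar> < \<bar>C\<bar>\<close> \<open>2 \<le> C\<close> that by linarith
    ultimately show ?thesis by (simp add: w_def')
  qed
  then show "0 < w s" .
  define c where "c s = R * cos (2 * (s + k))" for s
  \<comment> \<open>From w = u^2 and w' = c follows u' = c / (2 u).\<close>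
  define v where "v s = c s / (2 * u s)" for s
  have u: "0 < u s" "(u s)\<^sup>2 = w s" for s
    using w_pos[of s] by (auto simp: u_def)
  have c2: "(c s)\<^sup>2 = 4 * (C * w s - (w s)\<^sup>2 - 1)" for s
  proof -
    have "(c s)\<^sup>2 = R\<^sup>2 - (R * sin (2 * (s + k)))\<^sup>2"
      by (simp add: c_def power_mult_distrib cos_squared_eq algebra_simps)
    also have "R * sin (2 * (s + k)) = 2 * w s - C"
      by (simp add: w_def' field_simps)
    finally show ?thesis
      unfolding R2 by (simp add: power2_eq_square algebra_simps)
  qed
  have dw: "(w has_real_derivative c s) (at s)" for s
    unfolding w_def'[abs_def] c_def by (auto intro!: derivative_eq_intros)
  have dc: "(c has_real_derivative 2 * C - 4 * w s) (at s)" for s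
    unfolding c_def[abs_def] w_def' by (auto intro!: derivative_eq_intros simp: field_simps)
  have du: "(u has_real_derivative v s) (at s)" for s
    unfolding u_def v_def using w_pos[of s]
    by (auto intro!: derivative_eq_intros dw simp: field_simps)
  have v2: "(v s)\<^sup>2 = radicand 0 C (u s)" for s
  proof -
    have "(v s)\<^sup>2 = (c s)\<^sup>2 / (4 * (u s)\<^sup>2)"
      by (simp add: v_def power_divide power_mult_distrib)
    also have "\<dots> = C - w s - 1 / w s"
      unfolding c2 u(2) using w_pos[of s] by (simp add: field_simps power2_eq_square)
    finally show ?thesis
      by (simp add: radicand_def u(2))
  qed
  have "(v has_real_derivative 0 - u s + 1 / u s ^ 3) (at s)" for s
  proof -
    have "(v has_real_derivative
        ((2 * C - 4 * w s) * (2 * u s) - c s * (2 * v s)) / (2 * u s * (2 * u s))) (at s)"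
      unfolding v_def[abs_def] using u(1)[of s]
      by (auto intro!: derivative_eq_intros dc du simp: v_def)
    moreover have "((2 * C - 4 * w s) * (2 * u s) - c s * (2 * v s)) / (2 * u s * (2 * u s))
        = 0 - u s + 1 / u s ^ 3"
    proof -
      have "c s = 2 * u s * v s" using u(1)[of s] by (simp add: v_def)
      then have "((2 * C - 4 * w s) * (2 * u s) - c s * (2 * v s)) / (2 * u s * (2 * u s))
        = (C - 2 * (u s)\<^sup>2 - (v s)\<^sup>2) / u s"
        using u(1)[of s] by (simp add: u(2)[symmetric] field_simps power2_eq_square)
      \<comment> \<open>Eliminating v^2 by the first integral cancels \<open>C\<close>.\<close>
      also have "\<dots> = 0 - u s + 1 / u s ^ 3"
        unfolding v2 radicand_def using u(1)[of s]
        by (simp add: field_simps power2_eq_square power3_eq_cube)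
      finally show ?thesis .
    qed
    ultimately show ?thesis by simp
  qed
  then show "\<exists>v. profile_ode UNIV 0 u v \<and> (\<forall>s. (v s)\<^sup>2 = radicand 0 C (u s))"
    using u(1) du v2 unfolding profile_ode_def by blast
qed

section \<open>Classification of the stationary solutions\<close>

theorem theorem3p2:
  fixes I :: "real set"
  assumes "open I" and "is_interval I" and "I \<noteq> {}"
  shows
    "(\<forall>\<tau>. stationary_solution I \<tau> \<longrightarrow>
        (\<exists>A C u. (\<forall>s\<in>I. 0 < u s \<and> \<tau> s = 1 / (u s)\<^sup>2 \<and> torsion_flux \<tau> s = A) \<and>
                 given_by_integral_formula I A C u)) \<and>
     (\<forall>A C k u. integral_formula_on I A C k u \<longrightarrow>
        stationary_solution I (\<lambda>s. 1 / (u s)\<^sup>2) \<and>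
        (\<forall>s\<in>I. torsion_flux (\<lambda>s. 1 / (u s)\<^sup>2) s = A)) \<and>
     (\<forall>\<tau> C. (stationary_solution I \<tau> \<and>
             (\<exists>u. (\<forall>s\<in>I. 0 < u s \<and> \<tau> s = 1 / (u s)\<^sup>2 \<and> torsion_flux \<tau> s = 0) \<and>
                  given_by_integral_formula I 0 C u)) \<longleftrightarrow>
            (2 \<le> C \<and>
             (\<exists>k. \<exists>\<sigma>\<in>{1, -1}. \<forall>s\<in>I.
                \<tau> s = 2 / (C + \<sigma> * sqrt (-4 + C\<^sup>2) * sin (2 * (s + k))))))"
proof (intro conjI allI impI iffI)
  fix \<tau> assume st: "stationary_solution I \<tau>"
  define u where "u s = 1 / sqrt (\<tau> s)" for s
  have u: "0 < u s \<and> \<tau> s = 1 / (u s)\<^sup>2" if "s \<in> I" for s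
    using st that
    by (auto simp: stationary_solution_def torsion_evolution_solution_def u_def power_divide less_imp_le)
  have "\<exists>A. \<forall>s\<in>I. torsion_flux \<tau> s = A"
    using stationary_solution_flux_and_ode(1)[OF st assms(1) u]
    by (rule zero_derivative_constant_on_interval[OF assms(1,2)])
  then obtain A where A: "\<And>s. s \<in> I \<Longrightarrow> torsion_flux \<tau> s = A" by blast
  obtain v where ode: "profile_ode I A u v"
    using stationary_solution_flux_and_ode(2)[OF st assms(1) u] u A unfolding profile_ode_def by auto
  obtain C where "\<And>s. s \<in> I \<Longrightarrow> (v s)\<^sup>2 = radicand A C (u s)"
    using profile_ode_first_integral[OF ode assms(1,2)] by blast
  then show "\<exists>A C u. (\<forall>s\<in>I. 0 < u s \<and> \<tau> s = 1 / (u s)\<^sup>2 \<and> torsion_flux \<tau> s = A) \<and>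
      given_by_integral_formula I A C u"
    using profile_ode_imp_given_by_integral_formula[OF ode, of C] u A
    by (intro exI[of _ A] exI[of _ C] exI[of _ u]) simp
next
  fix A C k u assume "integral_formula_on I A C k u"
  then obtain v where ode: "profile_ode I A u v"
    using integral_formula_on_imp_profile_ode assms(1) by blast
  show "stationary_solution I (\<lambda>s. 1 / (u s)\<^sup>2)"
    using profile_ode_imp_stationary(1)[OF ode assms(1) refl] .
  show "\<forall>s\<in>I. torsion_flux (\<lambda>s. 1 / (u s)\<^sup>2) s = A"
    using profile_ode_imp_stationary(2)[OF ode assms(1) refl] by blast
next
  fix \<tau> C
  assume L: "stationary_solution I \<tau> \<and>
    (\<exists>u. (\<forall>s\<in>I. 0 < u s \<and> \<tau> s = 1 / (u s)\<^sup>2 \<and> torsion_flux \<tau> s = 0) \<and>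
      given_by_integral_formula I 0 C u)"
  then obtain u where u: "\<And>s. s \<in> I \<Longrightarrow> 0 < u s \<and> \<tau> s = 1 / (u s)\<^sup>2"
    and flux: "\<And>s. s \<in> I \<Longrightarrow> torsion_flux \<tau> s = 0" and g: "given_by_integral_formula I 0 C u"
    by blast
  obtain v where ode: "profile_ode I 0 u v"
    using stationary_solution_flux_and_ode(2)[OF conjunct1[OF L] assms(1) u] u flux
    unfolding profile_ode_def by auto
  \<comment> \<open>Here \<open>C\<close> is prescribed, so the first integral is read off the
    differential clause of the formula instead of being obtained with some unknown constant.\<close>
  have first: "(v s)\<^sup>2 = radicand 0 C (u s)" if "s \<in> I" for s
    using g that DERIV_imp_deriv[OF profile_odeD(2)[OF ode that]]
    by (auto simp: given_by_integral_formula_def)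
  show "2 \<le> C"
    using zero_flux_explicit(1)[OF ode assms first] .
  obtain k where k: "\<forall>s\<in>I. (u s)\<^sup>2 = (C + sqrt (-4 + C\<^sup>2) * sin (2 * (s + k))) / 2"
    using zero_flux_explicit(2)[OF ode assms first] by blast
  \<comment> \<open>The witness is \<sigma> = 1: a shift of \<open>k\<close> by pi / 2 reverses the
    sign of the sine, so the phase accounts for the sign.\<close>
  have "\<tau> s = 2 / (C + 1 * sqrt (-4 + C\<^sup>2) * sin (2 * (s + k)))" if "s \<in> I" for s
    unfolding conjunct2[OF u[OF that]] bspec[OF k that] by simp
  then show "\<exists>k. \<exists>\<sigma>\<in>{1, -1}. \<forall>s\<in>I.
      \<tau> s = 2 / (C + \<sigma> * sqrt (-4 + C\<^sup>2) * sin (2 * (s + k)))"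
    by blast
next
  fix \<tau> C
  assume R: "2 \<le> C \<and> (\<exists>k. \<exists>\<sigma>\<in>{1, -1}. \<forall>s\<in>I.
      \<tau> s = 2 / (C + \<sigma> * sqrt (-4 + C\<^sup>2) * sin (2 * (s + k))))"
  then obtain k and \<sigma> :: real where \<sigma>: "\<sigma> \<in> {1, -1}"
    and \<tau>: "\<And>s. s \<in> I \<Longrightarrow> \<tau> s = 2 / (C + \<sigma> * sqrt (-4 + C\<^sup>2) * sin (2 * (s + k)))"
    by blast
  define w where "w s = (C + \<sigma> * sqrt (-4 + C\<^sup>2) * sin (2 * (s + k))) / 2" for s
  define u where "u s = sqrt (w s)" for s
  note ex = explicit_profile_ode[OF conjunct1[OF R] \<sigma>, where k = k, folded w_def, folded u_def]
  obtain v where "profile_ode UNIV 0 u v" and first: "\<And>s. (v s)\<^sup>2 = radicand 0 C (u s)"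
    using ex(2) by blast
  then have ode: "profile_ode I 0 u v"
    using profile_ode_subset by blast
  have u: "0 < u s \<and> \<tau> s = 1 / (u s)\<^sup>2" if "s \<in> I" for s
    using ex(1)[of s] \<tau>[OF that] by (simp add: u_def w_def)
  show "stationary_solution I \<tau>"
    using profile_ode_imp_stationary(1)[OF ode assms(1), of \<tau>] u by simp
  show "\<exists>u. (\<forall>s\<in>I. 0 < u s \<and> \<tau> s = 1 / (u s)\<^sup>2 \<and> torsion_flux \<tau> s = 0) \<and>
      given_by_integral_formula I 0 C u"
    using profile_ode_imp_stationary(2)[OF ode assms(1), of \<tau>] u
      profile_ode_imp_given_by_integral_formula[OF ode first]
    by (intro exI[of _ u]) simp
qed

end
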